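(* In the setting described in the context, let $u_h(\omega)\in V^h_r$ be the solution of $$A_0(u_h,v_h)=F(\omega;v_h)-A_1(\omega;u_h,v_h)\qquad\text{for all }v_h\in V^h_r$$ (equivalently, $A(\omega;u_h,v_h)=F(\omega;v_h)$ for all $v_h\in V^h_r$), and let $\{U_n^h(\omega)\}_{n\ge0}\subset V^h_r$ be the sequence generated by the discrete iterative algorithm. Then there exists a constant $C>0$, independent of $\omega$ (and of $n$), such that $$\|u_h(\omega)-U_n^h(\omega)\|_V\le C\rho^{n+1}\qquad\text{for all }\omega\in\Omega\text{ and all }n\ge0.$$ Hence $U_n^h(\omega)$ converges to $u_h(\omega)$ strongly in $V$ as $n\to\infty$ for every $\omega\in\Omega$.
   Context: Let $H$ be a (real) Hilbert space, $V\subset H$ a (real) Banach space, and $V^*$ the dual space of bounded linear functionals on $V$. Let $\Omega$ be a set (the parameter space). For each $\omega\in\Omega$, let $F(\omega;\cdot)\in V^*$ and let $A(\omega;\cdot,\cdot):V\times V\to\mathbb{R}$ be a bilinear form (not necessarily symmetric). Assume there are constants $\Lambda>0$ and $\lambda>0$, independent of $\omega$, such that $|A(\omega;v,w)|\le\Lambda\|v\|_V\|w\|_V$ for all $v,w\in V$ and $A(\omega;v,v)\ge\lambda\|v\|_V^2$ for all $v\in V$. Assume also that there is an $\omega$-independent constant $C_F>0$ with $\|F(\omega)\|_{V^*}\le C_F$ for all $\omega\in\Omega$. Let $A_0(\cdot,\cdot):V\times V\to\mathbb{R}$ be an $\omega$-independent bilinear form, and set $A_1(\omega;\cdot,\cdot)=A(\omega;\cdot,\cdot)-A_0(\cdot,\cdot)$.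 Assume that there are constants $\Lambda_0,\lambda_0>0$ with $|A_0(v,w)|\le\Lambda_0\|v\|_V\|w\|_V$ for all $v,w\in V$ and $A_0(v,v)\ge\lambda_0\|v\|_V^2$ for all $v\in V$, and that there is $\rho\in(0,1)$ such that $\|A_1(\omega)\|_{\mathcal{L}(V\times V,\mathbb{R})}/\lambda_0<\rho$ for all $\omega\in\Omega$. Here the norm of a bounded bilinear form $B$ is $\|B\|_{\mathcal{L}(V\times V,\mathbb{R})}=\sup\{|B(v,w)|:\|v\|_V\le1,\ \|w\|_V\le1\}$. Finite element space: $V$ is a space of functions on a bounded domain $D\subset\mathbb{R}^d$ ($d=1,2,3$), $\mathcal{T}_h$ is a quasi-uniform triangulation of $D$ with mesh size $h\in(0,1)$, and $V^h_r$ ($r\ge1$) is the finite element space of continuous piecewise $r$th order polynomials associated with $\mathcal{T}_h$. It is assumed that $V^h_r$ is a subspace of $V$ (which implicitly assumes $V\subset W^{1,1}(D)$ but $V\not\subset W^{2,1}(D)$). The discrete problem $A(\omega;u_h,v_h)=F(\omega;v_h)$ for all $v_h\in V^h_r$ has a unique solution $u_h(\omega)\in V^h_r$. Discrete iterative algorithm: for each $\omega\in\Omega$, $U_0^h=U_0^h(\omega)\in V^h_r$ is defined by $A_0(U_0^h,v_h)=F(\omega;v_h)$ for all $v_h\in V^h_r$, and, for $n\ge1$, $U_n^h=U_n^h(\omega)\in V^h_r$ is defined recursively by $A_0(U_n^h,v_h)=F(\omega;v_h)-A_1(\omega;U_{n-1}^h,v_h)$ for all $v_h\in V^h_r$. 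*)

theory Defs
  imports "HOL-Analysis.Analysis"
begin

section \<open>Bilinear forms\<close>

definition bilinear_form_norm :: "('v::real_normed_vector \<Rightarrow> 'v \<Rightarrow> real) \<Rightarrow> real" where
  "bilinear_form_norm B = (SUP (v, w)\<in>cball 0 1 \<times> cball 0 1. \<bar>B v w\<bar>)"


section \<open>Weak derivatives and the spaces \<open>W\<^sup>k\<^sup>,\<^sup>1\<close>\<close>

definition partial :: "'d::finite \<Rightarrow> (real ^ 'd \<Rightarrow> real) \<Rightarrow> real ^ 'd \<Rightarrow> real" where
  "partial i f x = frechet_derivative f (at x) (axis i 1)"

primrec C_class :: "nat \<Rightarrow> (real ^ 'd::finite \<Rightarrow> real) \<Rightarrow> bool" where
  "C_class 0 f \<longleftrightarrow> continuous_on UNIV f"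
| "C_class (Suc k) f \<longleftrightarrow> f differentiable_on UNIV \<and> (\<forall>i. C_class k (partial i f))"

definition test_function :: "(real ^ 'd::finite) set \<Rightarrow> (real ^ 'd \<Rightarrow> real) \<Rightarrow> bool" where
  "test_function D \<psi> \<longleftrightarrow>
     (\<forall>k. C_class k \<psi>) \<and> compact (closure {x. \<psi> x \<noteq> 0}) \<and> closure {x. \<psi> x \<noteq> 0} \<subseteq> D"

definition weak_partial ::
  "(real ^ 'd::finite) set \<Rightarrow> 'd \<Rightarrow> (real ^ 'd \<Rightarrow> real) \<Rightarrow> (real ^ 'd \<Rightarrow> real) \<Rightarrow> bool" where
  "weak_partial D i f g \<longleftrightarrow>
     (\<forall>\<psi>. test_function D \<psi> \<longrightarrow>
        (LINT x|lebesgue_on D. f x * partial i \<psi> x) = - (LINT x|lebesgue_on D. g x * \<psi> x))"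

text \<open>
  The members of \<open>W_k1 k D\<close> are functions, not classes of functions that agree almost everywhere;
  the values outside \<open>D\<close> are irrelevant.
\<close>

primrec W_k1 :: "nat \<Rightarrow> (real ^ 'd::finite) set \<Rightarrow> (real ^ 'd \<Rightarrow> real) set" where
  "W_k1 0 D = {f. integrable (lebesgue_on D) f}"
| "W_k1 (Suc k) D =
     {f. integrable (lebesgue_on D) f \<and> (\<forall>i. \<exists>g\<in>W_k1 k D. weak_partial D i f g)}"


section \<open>Banach spaces of functions on a domain\<close>

text \<open>
  A Banach space \<open>V\<close> of (classes of) functions on \<open>D\<close> is a Banach space type together with a map
  \<open>\<phi>\<close> that picks a representative \<open>\<phi> v\<close> of each \<open>v\<close>. The map is linear and injective up to
  equality almost everywhere on \<open>D\<close>.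
\<close>

definition function_space_on ::
  "(real ^ 'd::finite) set \<Rightarrow> ('v::real_vector \<Rightarrow> real ^ 'd \<Rightarrow> real) \<Rightarrow> bool" where
  "function_space_on D \<phi> \<longleftrightarrow>
     (\<forall>v. \<phi> v \<in> borel_measurable (lebesgue_on D)) \<and>
     (\<forall>a b v w. AE x in lebesgue_on D. \<phi> (a *\<^sub>R v + b *\<^sub>R w) x = a * \<phi> v x + b * \<phi> w x) \<and>
     (\<forall>v. (AE x in lebesgue_on D. \<phi> v x = 0) \<longrightarrow> v = 0)"


section \<open>Quasi-uniform triangulations\<close>

text \<open>
  The library predicate \<open>triangulation\<close> says that the cells are simplices (of any dimension) that
  meet in common faces; here all cells are full-dimensional and closed.
\<close>

definition triangulation_of :: "(real ^ 'd::finite) set \<Rightarrow> (real ^ 'd) set set \<Rightarrow> bool" where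
  "triangulation_of D \<T> \<longleftrightarrow>
     triangulation \<T> \<and> (\<forall>K\<in>\<T>. int CARD('d) simplex K) \<and> \<Union>\<T> = closure D"

text \<open>
  Quasi-uniformity is a property of a family of triangulations, indexed by the mesh size \<open>h\<close> in a
  set \<open>Hs\<close>: one constant \<open>\<kappa>\<close> serves all \<open>h\<close>.
\<close>

definition quasi_uniform_triangulations ::
  "(real ^ 'd::finite) set \<Rightarrow> real set \<Rightarrow> (real \<Rightarrow> (real ^ 'd) set set) \<Rightarrow> bool" where
  "quasi_uniform_triangulations D Hs \<T> \<longleftrightarrow>
     (\<forall>h\<in>Hs. triangulation_of D (\<T> h) \<and> Max (diameter ` \<T> h) = h) \<and>
     (\<exists>\<kappa>>0. \<forall>h\<in>Hs. \<forall>K\<in>\<T> h. \<exists>x. ball x (\<kappa> * h) \<subseteq> K)"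


section \<open>Finite element spaces\<close>

definition polynomials_upto :: "nat \<Rightarrow> (real ^ 'd::finite \<Rightarrow> real) set" where
  "polynomials_upto r =
     {q. \<exists>c :: ('d \<Rightarrow> nat) \<Rightarrow> real.
           \<forall>x. q x = (\<Sum>\<alpha> | sum \<alpha> UNIV \<le> r. c \<alpha> * (\<Prod>i\<in>UNIV. x $ i ^ \<alpha> i))}"

text \<open>
  The set \<open>\<Gamma>\<close> is the part of the boundary that carries homogeneous Dirichlet conditions, so that
  spaces like \<open>H\<^sup>1\<^sub>0\<close> are covered; \<open>\<Gamma> = {}\<close> gives all continuous piecewise polynomials.
\<close>

definition continuous_piecewise_polynomials ::
  "nat \<Rightarrow> (real ^ 'd::finite) set set \<Rightarrow> (real ^ 'd) set \<Rightarrow> (real ^ 'd \<Rightarrow> real) set" where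
  "continuous_piecewise_polynomials r \<T> \<Gamma> =
     {p. continuous_on (\<Union>\<T>) p \<and>
         (\<forall>K\<in>\<T>. \<exists>q\<in>polynomials_upto r. \<forall>x\<in>K. p x = q x) \<and>
         (\<forall>x\<in>\<Gamma>. p x = 0)}"

text \<open>
  The inclusion of the piecewise polynomials in \<open>V\<close>, and the elements of \<open>V\<close> that they are
  (up to equality almost everywhere on \<open>D\<close>).
\<close>

definition fe_space_contained ::
  "(real ^ 'd::finite) set \<Rightarrow> ('v \<Rightarrow> real ^ 'd \<Rightarrow> real) \<Rightarrow> nat \<Rightarrow> (real ^ 'd) set set
    \<Rightarrow> (real ^ 'd) set \<Rightarrow> bool" where
  "fe_space_contained D \<phi> r \<T> \<Gamma> \<longleftrightarrow>
     (\<forall>p\<in>continuous_piecewise_polynomials r \<T> \<Gamma>. \<exists>v. AE x in lebesgue_on D. \<phi> v x = p x)"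

definition fe_space ::
  "(real ^ 'd::finite) set \<Rightarrow> ('v \<Rightarrow> real ^ 'd \<Rightarrow> real) \<Rightarrow> nat \<Rightarrow> (real ^ 'd) set set
    \<Rightarrow> (real ^ 'd) set \<Rightarrow> 'v set" where
  "fe_space D \<phi> r \<T> \<Gamma> =
     {v. \<exists>p\<in>continuous_piecewise_polynomials r \<T> \<Gamma>. AE x in lebesgue_on D. \<phi> v x = p x}"


section \<open>The discrete problem and the iteration\<close>

definition discrete_solution ::
  "'v set \<Rightarrow> ('v \<Rightarrow> 'v \<Rightarrow> real) \<Rightarrow> ('v \<Rightarrow> 'v \<Rightarrow> real) \<Rightarrow> ('v \<Rightarrow> real) \<Rightarrow> 'v \<Rightarrow> bool" where
  "discrete_solution V\<^sub>h A\<^sub>0 A\<^sub>1 F u \<longleftrightarrow>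
     u \<in> V\<^sub>h \<and> (\<forall>v\<in>V\<^sub>h. A\<^sub>0 u v = F v - A\<^sub>1 u v)"

definition discrete_iteration ::
  "'v set \<Rightarrow> ('v \<Rightarrow> 'v \<Rightarrow> real) \<Rightarrow> ('v \<Rightarrow> 'v \<Rightarrow> real) \<Rightarrow> ('v \<Rightarrow> real) \<Rightarrow> (nat \<Rightarrow> 'v) \<Rightarrow> bool"
  where
  "discrete_iteration V\<^sub>h A\<^sub>0 A\<^sub>1 F U \<longleftrightarrow>
     (\<forall>n. U n \<in> V\<^sub>h) \<and>
     (\<forall>v\<in>V\<^sub>h. A\<^sub>0 (U 0) v = F v) \<and>
     (\<forall>n\<ge>1. \<forall>v\<in>V\<^sub>h. A\<^sub>0 (U n) v = F v - A\<^sub>1 (U (n - 1)) v)"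

end

(* The error e(n) = u - U(n) satisfies A0 (e (n+1)) v = - A1 (e n) v on the finite element space;
   testing with v = e (n+1) shows that each step contracts the V-norm by norm A1 / lam0 < rho.
   With "U (-1) = 0" the same identity covers n = 0, so the constant is a bound on norm u,
   which coercivity of A provides uniformly in omega. *)
theory Submission
  imports Defs
begin

text \<open>Homogeneity: rescale \<open>v\<close> and \<open>w\<close> to unit vectors, where the
  supremum applies. The constant \<open>K\<close> is absent from the conclusion; it serves to make
  the supremum one of a bounded set, since \<open>SUP\<close> over an unbounded set of reals carries
  no information.\<close>

lemma bilinear_form_norm_bound:
  assumes B: "bilinear B" and K: "\<And>v w. \<bar>B v w\<bar> \<le> K * norm v * norm w"
  shows "\<bar>B v w\<bar> \<le> bilinear_form_norm B * norm v * norm w"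
proof (cases "v = 0 \<or> w = 0")
  case True
  \<comment> \<open>Zero vectors cannot be normalised; here the bound with \<open>K\<close> forces
    \<open>B v w = 0\<close>.\<close>
  then show ?thesis using K[of v w] by auto
next
  case False
  define v' w' where "v' = v /\<^sub>R norm v" and "w' = w /\<^sub>R norm w"
  \<comment> \<open>The upper bound is \<open>\<bar>K\<bar>\<close> rather than \<open>K\<close>
    because no sign of \<open>K\<close> is assumed.\<close>
  have "bdd_above ((\<lambda>(v, w). \<bar>B v w\<bar>) ` (cball 0 1 \<times> cball 0 1))"
  proof (rule bdd_aboveI2, clarify)
    fix x y :: 'a assume "x \<in> cball 0 1" "y \<in> cball 0 1"
    then have "norm x * norm y \<le> 1" by (simp add: mult_le_one)
    then have "\<bar>K\<bar> * (norm x * norm y) \<le> \<bar>K\<bar>" by (simp add: mult_left_le)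
    moreover have "K * norm x * norm y \<le> \<bar>K\<bar> * (norm x * norm y)"
      by (simp add: mult.assoc mult_right_mono)
    ultimately show "\<bar>B x y\<bar> \<le> \<bar>K\<bar>" using K[of x y] by linarith
  qed
  moreover have "(v', w') \<in> cball 0 1 \<times> cball 0 1"
    using False by (simp add: v'_def w'_def)
  ultimately have "(case (v', w') of (v, w) \<Rightarrow> \<bar>B v w\<bar>) \<le> bilinear_form_norm B"
    unfolding bilinear_form_norm_def by (intro cSUP_upper)
  then have "\<bar>B v' w'\<bar> \<le> bilinear_form_norm B" by simp
  moreover have "B v' w' = B v w / (norm v * norm w)"
    by (simp add: v'_def w'_def bilinear_lmul[OF B] bilinear_rmul[OF B] field_simps)
  ultimately show ?thesis using False by (simp add: abs_divide abs_mult field_simps)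
qed

text \<open>Cancel one factor \<open>norm v\<close> from the coercivity estimate. This is the
  Lax-Milgram stability argument, used below with \<open>A\<close> to bound the discrete solution
  and with \<open>A\<^sub>0\<close> to contract the error.\<close>

lemma coercive_imp_norm_le:
  fixes B :: "'v::real_normed_vector \<Rightarrow> 'v \<Rightarrow> real"
  assumes "c > 0" "c * (norm v)\<^sup>2 \<le> B v v" "B v v \<le> K * norm v" "K \<ge> 0"
  shows "norm v \<le> K / c"
proof (cases "v = 0")
  case False
  have "(c * norm v) * norm v \<le> K * norm v"
    using assms(2,3) by (simp add: power2_eq_square mult.assoc)
  with False assms(1) show ?thesis by (simp add: field_simps)
qed (use assms in simp)

lemma polynomials_upto_linear_combination:
  assumes "p \<in> polynomials_upto r" "q \<in> polynomials_upto r"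
  shows "(\<lambda>x. a * p x + b * q x) \<in> polynomials_upto r"
proof -
  let ?m = "\<lambda>\<alpha> x. \<Prod>i\<in>UNIV. x $ i ^ \<alpha> i :: real"
  obtain c d where cd: "\<And>x. p x = (\<Sum>\<alpha> | sum \<alpha> UNIV \<le> r. c \<alpha> * ?m \<alpha> x)"
    "\<And>x. q x = (\<Sum>\<alpha> | sum \<alpha> UNIV \<le> r. d \<alpha> * ?m \<alpha> x)"
    using assms unfolding polynomials_upto_def by blast
  have "a * p x + b * q x = (\<Sum>\<alpha> | sum \<alpha> UNIV \<le> r. (a * c \<alpha> + b * d \<alpha>) * ?m \<alpha> x)" for x
    by (simp add: cd sum_distrib_left sum.distrib distrib_right mult.assoc)
  then show ?thesis
    unfolding polynomials_upto_def mem_Collect_eq by (intro exI allI)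
qed

lemma continuous_piecewise_polynomials_linear_combination:
  assumes p: "p \<in> continuous_piecewise_polynomials r \<T> \<Gamma>"
    and q: "q \<in> continuous_piecewise_polynomials r \<T> \<Gamma>"
  shows "(\<lambda>x. a * p x + b * q x) \<in> continuous_piecewise_polynomials r \<T> \<Gamma>"
proof -
  have "\<exists>s\<in>polynomials_upto r. \<forall>x\<in>K. a * p x + b * q x = s x" if K: "K \<in> \<T>" for K
  proof -
    obtain p' q' where "p' \<in> polynomials_upto r" "\<forall>x\<in>K. p x = p' x"
      and "q' \<in> polynomials_upto r" "\<forall>x\<in>K. q x = q' x"
      using p q K unfolding continuous_piecewise_polynomials_def by blast
    then show ?thesis
      by (intro bexI[where x = "\<lambda>x. a * p' x + b * q' x"] polynomials_upto_linear_combination) simp_all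
  qed
  moreover have "continuous_on (\<Union>\<T>) (\<lambda>x. a * p x + b * q x)"
    using p q unfolding continuous_piecewise_polynomials_def by (intro continuous_intros) blast+
  moreover have "\<forall>x\<in>\<Gamma>. a * p x + b * q x = 0"
    using p q unfolding continuous_piecewise_polynomials_def by simp
  ultimately show ?thesis
    unfolding continuous_piecewise_polynomials_def by blast
qed

text \<open>Makes the error of an iterate an admissible test function. Since \<open>\<phi>\<close>
  is linear only almost everywhere, the exceptional null sets of \<open>v\<close>, \<open>w\<close>
  and the linearity relation have to be combined.\<close>

lemma fe_space_diff:
  assumes \<phi>: "function_space_on D \<phi>"
    and v: "v \<in> fe_space D \<phi> r \<T> \<Gamma>" and w: "w \<in> fe_space D \<phi> r \<T> \<Gamma>"
  shows "v - w \<in> fe_space D \<phi> r \<T> \<Gamma>"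
proof -
  obtain p q where p: "p \<in> continuous_piecewise_polynomials r \<T> \<Gamma>"
      "AE x in lebesgue_on D. \<phi> v x = p x"
    and q: "q \<in> continuous_piecewise_polynomials r \<T> \<Gamma>"
      "AE x in lebesgue_on D. \<phi> w x = q x"
    using v w unfolding fe_space_def by blast
  \<comment> \<open>The difference is written as a combination with coefficients 1 and -1 to match
    the form of linearity in \<open>function_space_on\<close>.\<close>
  have "AE x in lebesgue_on D. \<phi> (1 *\<^sub>R v + (-1) *\<^sub>R w) x = 1 * \<phi> v x + (-1) * \<phi> w x"
    using \<phi> unfolding function_space_on_def by blast
  with p(2) q(2) have "AE x in lebesgue_on D. \<phi> (v - w) x = 1 * p x + (-1) * q x"
    by eventually_elim simp
  then show ?thesis
    unfolding fe_space_def mem_Collect_eq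
    by (rule bexI[OF _ continuous_piecewise_polynomials_linear_combination[OF p(1) q(1)]])
qed

text \<open>Testing the equation with \<open>u\<close> itself recombines \<open>A\<^sub>0\<close>
  and \<open>A\<^sub>1\<close> into \<open>A\<close>, whose coercivity constant does not depend on
  the parameter.\<close>

lemma discrete_solution_norm_le:
  fixes F :: "'v::real_normed_vector \<Rightarrow>\<^sub>L real"
  assumes "discrete_solution S A\<^sub>0 A\<^sub>1 (blinfun_apply F) u"
    and A1: "\<And>v w. A\<^sub>1 v w = A v w - A\<^sub>0 v w"
    and "lam > 0" and coercive: "\<And>v. A v v \<ge> lam * (norm v)\<^sup>2"
  shows "norm u \<le> norm F / lam"
proof -
  have "A u u = F u"
    using assms(1) A1[of u u] unfolding discrete_solution_def by force
  moreover have "F u \<le> norm F * norm u"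
    using norm_blinfun[of F u] by simp
  ultimately show ?thesis
    using \<open>lam > 0\<close> coercive[of u] by (intro coercive_imp_norm_le[where B = A]) auto
qed

text \<open>Induction on \<open>n\<close> with contraction factor \<open>\<rho>\<close>. The finite
  element space is abstracted to a set \<open>S\<close> closed under differences, which is what lets
  the error be its own test function.\<close>

lemma discrete_iteration_error:
  assumes S: "\<And>v w. v \<in> S \<Longrightarrow> w \<in> S \<Longrightarrow> v - w \<in> S"
    and A0: "bilinear A\<^sub>0" and "lam\<^sub>0 > 0" and A0_coercive: "\<And>v. A\<^sub>0 v v \<ge> lam\<^sub>0 * (norm v)\<^sup>2"
    and A1: "bilinear A\<^sub>1" and A1_bounded: "\<And>v w. \<bar>A\<^sub>1 v w\<bar> \<le> \<rho> * lam\<^sub>0 * norm v * norm w"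
    and "\<rho> \<ge> 0"
    and u: "discrete_solution S A\<^sub>0 A\<^sub>1 F u"
    and U: "discrete_iteration S A\<^sub>0 A\<^sub>1 F U"
  shows "norm (u - U n) \<le> norm u * \<rho> ^ (n + 1)"
proof -
  \<comment> \<open>Here \<open>x\<close> is the new iterate and \<open>y\<close> the preceding
    error. Leaving \<open>y\<close> arbitrary lets the base case take \<open>y = u\<close>.\<close>
  have step: "norm (u - x) \<le> \<rho> * norm y"
    if x: "x \<in> S" and err: "\<And>v. v \<in> S \<Longrightarrow> A\<^sub>0 (u - x) v = - A\<^sub>1 y v" for x y
  proof -
    have "u - x \<in> S" using S u x unfolding discrete_solution_def by blast
    then have "A\<^sub>0 (u - x) (u - x) = - A\<^sub>1 y (u - x)" by (rule err)
    also have "\<dots> \<le> \<rho> * lam\<^sub>0 * norm y * norm (u - x)"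
      using A1_bounded[of y "u - x"] by linarith
    \<comment> \<open>The factor \<open>lam\<^sub>0\<close> in the bound for
      \<open>A\<^sub>1\<close> cancels against the coercivity constant of \<open>A\<^sub>0\<close>,
      leaving exactly \<open>\<rho>\<close>.\<close>
    finally have "norm (u - x) \<le> \<rho> * lam\<^sub>0 * norm y / lam\<^sub>0"
      using \<open>lam\<^sub>0 > 0\<close> \<open>\<rho> \<ge> 0\<close> A0_coercive[of "u - x"]
      by (intro coercive_imp_norm_le[where B = A\<^sub>0]) auto
    with \<open>lam\<^sub>0 > 0\<close> show ?thesis by simp
  qed
  show ?thesis
  proof (induction n)
    case 0
    \<comment> \<open>Subtracting the equations for \<open>u\<close> and \<open>U 0\<close> leaves
      \<open>- A\<^sub>1 u v\<close>, so already the initial guess gains one factor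
      \<open>\<rho>\<close>; hence the exponent \<open>n + 1\<close>.\<close>
    have "norm (u - U 0) \<le> \<rho> * norm u"
      using u U unfolding discrete_solution_def discrete_iteration_def
      by (intro step) (auto simp: bilinear_lsub[OF A0])
    then show ?case by (simp add: mult.commute)
  next
    case (Suc n)
    have "A\<^sub>0 (U (Suc n)) v = F v - A\<^sub>1 (U n) v" if "v \<in> S" for v
      using U that unfolding discrete_iteration_def by force
    then have "norm (u - U (Suc n)) \<le> \<rho> * norm (u - U n)"
      using u U unfolding discrete_solution_def discrete_iteration_def
      by (intro step) (auto simp: bilinear_lsub[OF A0] bilinear_lsub[OF A1])
    also have "\<dots> \<le> \<rho> * (norm u * \<rho> ^ (n + 1))"
      using Suc \<open>\<rho> \<ge> 0\<close> by (rule mult_left_mono)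
    finally show ?case by (simp add: algebra_simps)
  qed
qed

theorem theorem4p2:
  fixes \<iota> :: "'v::banach \<Rightarrow> 'h::{real_inner, complete_space}"
    and \<phi> :: "'v \<Rightarrow> real ^ 'd::finite \<Rightarrow> real"
    and D \<Gamma> :: "(real ^ 'd) set"
    and Hs :: "real set"
    and \<T> :: "real \<Rightarrow> (real ^ 'd) set set"
    and h :: real
    and r :: nat
    and \<Omega> :: "'w set"
    and F :: "'w \<Rightarrow> 'v \<Rightarrow>\<^sub>L real"
    and A A\<^sub>1 :: "'w \<Rightarrow> 'v \<Rightarrow> 'v \<Rightarrow> real"
    and A\<^sub>0 :: "'v \<Rightarrow> 'v \<Rightarrow> real"
    and \<Lambda> lam C_F \<Lambda>\<^sub>0 lam\<^sub>0 \<rho> :: real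
    and V\<^sub>h :: "'v set"
    and u\<^sub>h :: "'w \<Rightarrow> 'v"
    and U :: "'w \<Rightarrow> nat \<Rightarrow> 'v"
  assumes V_subset_H: "linear \<iota>" "inj \<iota>"
    and A_bilinear: "\<And>\<omega>. \<omega> \<in> \<Omega> \<Longrightarrow> bilinear (A \<omega>)"
    and A_consts: "\<Lambda> > 0" "lam > 0"
    and A_bounded: "\<And>\<omega> v w. \<omega> \<in> \<Omega> \<Longrightarrow> \<bar>A \<omega> v w\<bar> \<le> \<Lambda> * norm v * norm w"
    and A_coercive: "\<And>\<omega> v. \<omega> \<in> \<Omega> \<Longrightarrow> A \<omega> v v \<ge> lam * (norm v)\<^sup>2"
    and F_const: "C_F > 0"
    and F_bounded: "\<And>\<omega>. \<omega> \<in> \<Omega> \<Longrightarrow> norm (F \<omega>) \<le> C_F"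
    and A0_bilinear: "bilinear A\<^sub>0"
    and A0_consts: "\<Lambda>\<^sub>0 > 0" "lam\<^sub>0 > 0"
    and A0_bounded: "\<And>v w. \<bar>A\<^sub>0 v w\<bar> \<le> \<Lambda>\<^sub>0 * norm v * norm w"
    and A0_coercive: "\<And>v. A\<^sub>0 v v \<ge> lam\<^sub>0 * (norm v)\<^sup>2"
    and A1_def: "\<And>\<omega> v w. A\<^sub>1 \<omega> v w = A \<omega> v w - A\<^sub>0 v w"
    and rho: "0 < \<rho>" "\<rho> < 1"
    and A1_small: "\<And>\<omega>. \<omega> \<in> \<Omega> \<Longrightarrow> bilinear_form_norm (A\<^sub>1 \<omega>) / lam\<^sub>0 < \<rho>"
    and dimension: "CARD('d) \<in> {1, 2, 3}"
    and D_domain: "open D" "connected D" "bounded D" "D \<noteq> {}"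
    and V_functions: "function_space_on D \<phi>"
    and V_in_W11: "range \<phi> \<subseteq> W_k1 1 D"
    and V_not_in_W21: "\<not> range \<phi> \<subseteq> W_k1 2 D"
    and mesh_sizes: "Hs \<subseteq> {0<..<1}" "h \<in> Hs"
    and mesh: "quasi_uniform_triangulations D Hs \<T>"
    and r: "r \<ge> 1"
    and Gamma: "\<Gamma> \<subseteq> frontier D"
    and Vh_subset_V: "fe_space_contained D \<phi> r (\<T> h) \<Gamma>"
    and Vh_def: "V\<^sub>h = fe_space D \<phi> r (\<T> h) \<Gamma>"
    and u: "\<And>\<omega>. \<omega> \<in> \<Omega> \<Longrightarrow> discrete_solution V\<^sub>h A\<^sub>0 (A\<^sub>1 \<omega>) (blinfun_apply (F \<omega>)) (u\<^sub>h \<omega>)"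
    and U: "\<And>\<omega>. \<omega> \<in> \<Omega> \<Longrightarrow> discrete_iteration V\<^sub>h A\<^sub>0 (A\<^sub>1 \<omega>) (blinfun_apply (F \<omega>)) (U \<omega>)"
  shows "(\<exists>C>0. \<forall>\<omega>\<in>\<Omega>. \<forall>n. norm (u\<^sub>h \<omega> - U \<omega> n) \<le> C * \<rho> ^ (n + 1)) \<and>
         (\<forall>\<omega>\<in>\<Omega>. U \<omega> \<longlonglongrightarrow> u\<^sub>h \<omega>)"
proof -
  \<comment> \<open>The constant \<open>C_F / lam\<close> bounds
    \<open>norm (u\<^sub>h \<omega>)\<close> uniformly in \<open>\<omega>\<close>.\<close>
  have error: "norm (u\<^sub>h \<omega> - U \<omega> n) \<le> C_F / lam * \<rho> ^ (n + 1)" if \<omega>: "\<omega> \<in> \<Omega>" for \<omega> n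
  proof -
    note A = A_bilinear[OF \<omega>]
    have A1_bilinear: "bilinear (A\<^sub>1 \<omega>)"
      using A A0_bilinear unfolding bilinear_def A1_def by (auto intro: linear_compose_sub)
    \<comment> \<open>This crude triangle-inequality bound only certifies that the form norm of
      \<open>A\<^sub>1 \<omega>\<close> is a genuine supremum; the sharp constant
      \<open>\<rho> * lam\<^sub>0\<close> then comes from the smallness assumption.\<close>
    have "\<bar>A\<^sub>1 \<omega> v w\<bar> \<le> (\<Lambda> + \<Lambda>\<^sub>0) * norm v * norm w" for v w
      using A_bounded[OF \<omega>, of v w] A0_bounded[of v w] by (simp add: A1_def algebra_simps)
    then have "\<bar>A\<^sub>1 \<omega> v w\<bar> \<le> bilinear_form_norm (A\<^sub>1 \<omega>) * norm v * norm w" for v w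
      by (rule bilinear_form_norm_bound[OF A1_bilinear])
    moreover have "bilinear_form_norm (A\<^sub>1 \<omega>) \<le> \<rho> * lam\<^sub>0"
      using A1_small[OF \<omega>] A0_consts(2) by (simp add: field_simps)
    ultimately have A1_bounded: "\<bar>A\<^sub>1 \<omega> v w\<bar> \<le> \<rho> * lam\<^sub>0 * norm v * norm w" for v w
      by (meson mult_right_mono norm_ge_zero order_trans)
    have "norm (u\<^sub>h \<omega> - U \<omega> n) \<le> norm (u\<^sub>h \<omega>) * \<rho> ^ (n + 1)"
      using fe_space_diff[OF V_functions] A0_consts(2) A0_coercive A1_bounded rho(1) u[OF \<omega>] U[OF \<omega>]
      unfolding Vh_def
      by (intro discrete_iteration_error[OF _ A0_bilinear _ _ A1_bilinear]) auto
    also have "\<dots> \<le> C_F / lam * \<rho> ^ (n + 1)"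
    proof (rule mult_right_mono)
      have "norm (u\<^sub>h \<omega>) \<le> norm (F \<omega>) / lam"
        using u[OF \<omega>] A1_def A_consts(2) A_coercive[OF \<omega>] by (rule discrete_solution_norm_le)
      also have "\<dots> \<le> C_F / lam"
        using F_bounded[OF \<omega>] A_consts(2) by (simp add: divide_right_mono)
      finally show "norm (u\<^sub>h \<omega>) \<le> C_F / lam" .
    qed (use rho in simp)
    finally show ?thesis .
  qed
  have "U \<omega> \<longlonglongrightarrow> u\<^sub>h \<omega>" if \<omega>: "\<omega> \<in> \<Omega>" for \<omega>
  proof -
    \<comment> \<open>Since \<open>\<rho> < 1\<close>, the geometric error bound tends to zero and
      dominates \<open>norm (U \<omega> n - u\<^sub>h \<omega>)\<close>.\<close>
    have "(\<lambda>n. C_F / lam * \<rho> ^ (n + 1)) \<longlonglongrightarrow> C_F / lam * 0"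
      using rho by (intro tendsto_mult_left LIMSEQ_ignore_initial_segment LIMSEQ_power_zero) simp
    then have "(\<lambda>n. U \<omega> n - u\<^sub>h \<omega>) \<longlonglongrightarrow> 0"
      using error[OF \<omega>] by (intro Lim_null_comparison[of "\<lambda>n. U \<omega> n - u\<^sub>h \<omega>"])
        (auto simp: norm_minus_commute)
    then show ?thesis by (simp add: LIM_zero_iff)
  qed
  moreover have "C_F / lam > 0" using F_const A_consts by simp
  ultimately show ?thesis using error by blast
qed

end
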